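(* Let $\Omega\subset\mathbb{R}^n$ be convex, let $|\cdot|$ be a norm on $\mathbb{R}^n$, and let $\dot x=f(t,x)$ be a time-varying system evolving on $\Omega$. If the system is nested contractive (NC) on $\Omega$ with respect to $|\cdot|$, then it is a contraction after a small overshoot and short transient (SOST) on $\Omega$ with respect to $|\cdot|$; that is, for each $\varepsilon>0$ and each $\tau>0$ there exists $\ell=\ell(\tau,\varepsilon)>0$ such that $$|x(t_2+\tau,t_1,a)-x(t_2+\tau,t_1,b)|\le(1+\varepsilon)\exp(-(t_2-t_1)\ell)\,|a-b|$$ for all $t_2\ge t_1\ge0$ and all $a,b\in\Omega$.
   Context: Standing assumptions: $f(t,x)$ is defined for $t\ge 0$, $x\in\Omega$, takes values in $\mathbb{R}^n$, is differentiable with respect to $x$, and both $f(t,x)$ and $J(t,x):=\frac{\partial f}{\partial x}(t,x)$ are continuous in $(t,x)$. For all $t_0\ge0$ and $x_0\in\Omega$, the solution $x(t,t_0,x_0)$ with $x(t_0)=x_0$ exists, is unique, and stays in $\Omega$ for all $t\ge t_0$. Contractive: the system is contractive on a set $S\subseteq\Omega$ with respect to a norm $\|\cdot\|$ on $\mathbb{R}^n$ if there exists $c>0$ such that $\|x(t_2,t_1,a)-x(t_2,t_1,b)\|\le\exp(-(t_2-t_1)c)\,\|a-b\|$ for all $t_2\ge t_1\ge0$ and all $a,b\in S$. Non-expansive (non-expanding): the system is non-expansive on $\Omega$ with respect to $|\cdot|$ if $|x(s_2,s_1,a)-x(s_2,s_1,b)|\le|a-b|$ for all $a,b\in\Omega$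 and all $s_2>s_1\ge0$. Nested contractive (NC): the system is NC on $\Omega$ with respect to the norm $|\cdot|$ if there exist convex sets $\Omega_\zeta\subseteq\Omega$ and norms $|\cdot|_\zeta:\mathbb{R}^n\to\mathbb{R}_+$, $\zeta\in(0,1/2]$, such that: (i) $\bigcup_{\zeta\in(0,1/2]}\Omega_\zeta=\Omega$, and $\Omega_{\zeta_1}\subseteq\Omega_{\zeta_2}$ for all $\zeta_1\ge\zeta_2$; (ii) for every $\tau>0$ there exists $\zeta=\zeta(\tau)\in(0,1/2]$, with $\zeta(\tau)\to0$ as $\tau\to0$, such that for every $a\in\Omega$ and every $t_1\ge0$, $x(t,t_1,a)\in\Omega_\zeta$ for all $t\ge t_1+\tau$, and the system is contractive on $\Omega_\zeta$ with respect to $|\cdot|_\zeta$; (iii) the norms $|\cdot|_\zeta$ converge to $|\cdot|$ as $\zeta\to0$, i.e., for every $\zeta\in(0,1/2]$ there exists $s=s(\zeta)>0$, with $s(\zeta)\to0$ as $\zeta\to0$, such that $(1-s)|y|\le|y|_\zeta\le(1+s)|y|$ for all $y\in\Omega$; (iv) the system is non-expansive with respect to $|\cdot|$ on $\Omega$. *)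

theory Defs
  imports "HOL-Analysis.Analysis"
begin

definition is_norm :: "('a::real_vector \<Rightarrow> real) \<Rightarrow> bool" where
  "is_norm N \<longleftrightarrow>
     (\<forall>y. 0 \<le> N y) \<and>
     (\<forall>y. N y = 0 \<longleftrightarrow> y = 0) \<and>
     (\<forall>r y. N (r *\<^sub>R y) = \<bar>r\<bar> * N y) \<and>
     (\<forall>y z. N (y + z) \<le> N y + N z)"

text \<open>The set \<open>\<Omega>\<close> need not be open, so the derivative in \<open>x\<close> is taken within \<open>\<Omega>\<close>. If
  \<open>\<Omega>\<close> has empty interior the Jacobian is not determined by \<open>f\<close>; then some continuous
  choice of it is required to exist.\<close>

definition C1_vector_field ::
  "(real \<Rightarrow> real^'n \<Rightarrow> real^'n) \<Rightarrow> (real^'n) set \<Rightarrow> bool" where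
  "C1_vector_field f \<Omega> \<longleftrightarrow>
     continuous_on ({0..} \<times> \<Omega>) (\<lambda>(t, x). f t x) \<and>
     (\<exists>J :: real \<Rightarrow> real^'n \<Rightarrow> real^'n^'n.
        (\<forall>t\<ge>0. \<forall>x\<in>\<Omega>. (f t has_derivative (\<lambda>h. J t x *v h)) (at x within \<Omega>)) \<and>
        continuous_on ({0..} \<times> \<Omega>) (\<lambda>(t, x). J t x))"

definition is_solution ::
  "(real \<Rightarrow> real^'n \<Rightarrow> real^'n) \<Rightarrow> (real^'n) set \<Rightarrow> real \<Rightarrow> real^'n \<Rightarrow> (real \<Rightarrow> real^'n) \<Rightarrow> bool" where
  "is_solution f \<Omega> t\<^sub>0 x\<^sub>0 \<phi> \<longleftrightarrow>
     \<phi> t\<^sub>0 = x\<^sub>0 \<and>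
     (\<forall>t\<ge>t\<^sub>0. \<phi> t \<in> \<Omega> \<and> (\<phi> has_vector_derivative f t (\<phi> t)) (at t within {t\<^sub>0..}))"

definition unique_global_solutions ::
  "(real \<Rightarrow> real^'n \<Rightarrow> real^'n) \<Rightarrow> (real^'n) set \<Rightarrow> bool" where
  "unique_global_solutions f \<Omega> \<longleftrightarrow>
     (\<forall>t\<^sub>0\<ge>0. \<forall>x\<^sub>0\<in>\<Omega>.
        (\<exists>\<phi>. is_solution f \<Omega> t\<^sub>0 x\<^sub>0 \<phi>) \<and>
        (\<forall>\<phi> \<psi>. is_solution f \<Omega> t\<^sub>0 x\<^sub>0 \<phi> \<longrightarrow> is_solution f \<Omega> t\<^sub>0 x\<^sub>0 \<psi> \<longrightarrow>
           (\<forall>t\<ge>t\<^sub>0. \<phi> t = \<psi> t)))"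

definition system_on ::
  "(real \<Rightarrow> real^'n \<Rightarrow> real^'n) \<Rightarrow> (real^'n) set \<Rightarrow> bool" where
  "system_on f \<Omega> \<longleftrightarrow> C1_vector_field f \<Omega> \<and> unique_global_solutions f \<Omega>"

text \<open>\<open>trajectory f \<Omega> t t\<^sub>0 x\<^sub>0\<close> is the value $x(t,t_0,x_0)$. It is meaningful only for
  \<open>0 \<le> t\<^sub>0\<close>, \<open>t\<^sub>0 \<le> t\<close> and \<open>x\<^sub>0 \<in> \<Omega>\<close>, where \<open>unique_global_solutions f \<Omega>\<close> makes it independent of
  the choice: solutions are unique on \<open>{t\<^sub>0..}\<close>, while as functions on all reals they may
  differ before \<open>t\<^sub>0\<close>.\<close>

definition trajectory ::
  "(real \<Rightarrow> real^'n \<Rightarrow> real^'n) \<Rightarrow> (real^'n) set \<Rightarrow> real \<Rightarrow> real \<Rightarrow> real^'n \<Rightarrow> real^'n" where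
  "trajectory f \<Omega> t t\<^sub>0 x\<^sub>0 = (SOME \<phi>. is_solution f \<Omega> t\<^sub>0 x\<^sub>0 \<phi>) t"

definition contractive_on ::
  "(real \<Rightarrow> real^'n \<Rightarrow> real^'n) \<Rightarrow> (real^'n) set \<Rightarrow> (real^'n) set \<Rightarrow> (real^'n \<Rightarrow> real) \<Rightarrow> bool" where
  "contractive_on f \<Omega> S N \<longleftrightarrow>
     (\<exists>c>0. \<forall>t\<^sub>1 t\<^sub>2. \<forall>a\<in>S. \<forall>b\<in>S. 0 \<le> t\<^sub>1 \<and> t\<^sub>1 \<le> t\<^sub>2 \<longrightarrow>
        N (trajectory f \<Omega> t\<^sub>2 t\<^sub>1 a - trajectory f \<Omega> t\<^sub>2 t\<^sub>1 b) \<le> exp (- (t\<^sub>2 - t\<^sub>1) * c) * N (a - b))"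

definition non_expansive ::
  "(real \<Rightarrow> real^'n \<Rightarrow> real^'n) \<Rightarrow> (real^'n) set \<Rightarrow> (real^'n \<Rightarrow> real) \<Rightarrow> bool" where
  "non_expansive f \<Omega> N \<longleftrightarrow>
     (\<forall>s\<^sub>1 s\<^sub>2. \<forall>a\<in>\<Omega>. \<forall>b\<in>\<Omega>. 0 \<le> s\<^sub>1 \<and> s\<^sub>1 < s\<^sub>2 \<longrightarrow>
        N (trajectory f \<Omega> s\<^sub>2 s\<^sub>1 a - trajectory f \<Omega> s\<^sub>2 s\<^sub>1 b) \<le> N (a - b))"

text \<open>The norm comparison below is required only for \<open>y \<in> \<Omega>\<close>, not for all vectors.\<close>

definition nested_contractive ::
  "(real \<Rightarrow> real^'n \<Rightarrow> real^'n) \<Rightarrow> (real^'n) set \<Rightarrow> (real^'n \<Rightarrow> real) \<Rightarrow> bool" where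
  "nested_contractive f \<Omega> N \<longleftrightarrow>
     (\<exists>(W :: real \<Rightarrow> (real^'n) set) (M :: real \<Rightarrow> real^'n \<Rightarrow> real).
        (\<forall>\<zeta>\<in>{0<..1/2}. convex (W \<zeta>) \<and> W \<zeta> \<subseteq> \<Omega> \<and> is_norm (M \<zeta>)) \<and>
        (\<Union>\<zeta>\<in>{0<..1/2}. W \<zeta>) = \<Omega> \<and>
        (\<forall>\<zeta>\<^sub>1\<in>{0<..1/2}. \<forall>\<zeta>\<^sub>2\<in>{0<..1/2}. \<zeta>\<^sub>1 \<ge> \<zeta>\<^sub>2 \<longrightarrow> W \<zeta>\<^sub>1 \<subseteq> W \<zeta>\<^sub>2) \<and>
        (\<exists>z :: real \<Rightarrow> real.
           (z \<longlongrightarrow> 0) (at_right 0) \<and>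
           (\<forall>\<tau>>0. z \<tau> \<in> {0<..1/2} \<and>
              (\<forall>a\<in>\<Omega>. \<forall>t\<^sub>1\<ge>0. \<forall>t\<ge>t\<^sub>1 + \<tau>. trajectory f \<Omega> t t\<^sub>1 a \<in> W (z \<tau>)) \<and>
              contractive_on f \<Omega> (W (z \<tau>)) (M (z \<tau>)))) \<and>
        (\<exists>s :: real \<Rightarrow> real.
           (s \<longlongrightarrow> 0) (at_right 0) \<and>
           (\<forall>\<zeta>\<in>{0<..1/2}. s \<zeta> > 0 \<and>
              (\<forall>y\<in>\<Omega>. (1 - s \<zeta>) * N y \<le> M \<zeta> y \<and> M \<zeta> y \<le> (1 + s \<zeta>) * N y))) \<and>
        non_expansive f \<Omega> N)"

text \<open>Contraction after a small overshoot and short transient.\<close>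

definition SOST ::
  "(real \<Rightarrow> real^'n \<Rightarrow> real^'n) \<Rightarrow> (real^'n) set \<Rightarrow> (real^'n \<Rightarrow> real) \<Rightarrow> bool" where
  "SOST f \<Omega> N \<longleftrightarrow>
     (\<forall>\<epsilon>>0. \<forall>\<tau>>0. \<exists>l>0. \<forall>t\<^sub>1 t\<^sub>2. \<forall>a\<in>\<Omega>. \<forall>b\<in>\<Omega>. 0 \<le> t\<^sub>1 \<and> t\<^sub>1 \<le> t\<^sub>2 \<longrightarrow>
        N (trajectory f \<Omega> (t\<^sub>2 + \<tau>) t\<^sub>1 a - trajectory f \<Omega> (t\<^sub>2 + \<tau>) t\<^sub>1 b)
          \<le> (1 + \<epsilon>) * exp (- (t\<^sub>2 - t\<^sub>1) * l) * N (a - b))"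

end

theory Submission
  imports Defs
begin

text \<open>Write \<open>D\<close> for the \<open>N\<close>-distance of two trajectories at time \<open>t\<^sub>2 + \<tau>\<close> and \<open>s = t\<^sub>2 - t\<^sub>1\<close> for
  the elapsed time beyond the transient. Two bounds on \<open>D\<close> are available. Non-expansiveness
  gives \<open>D \<le> N (a - b)\<close>. On the other hand, at time \<open>t\<^sub>1 + \<tau>\<close> both trajectories lie in a set on
  which the system contracts with some rate \<open>c\<close> in an auxiliary norm; restarting the flow there
  (\<open>trajectory_cocycle\<close>) gives exponential decay in that norm. Norms on a finite-dimensional
  space are equivalent (\<open>is_norm_equivalent\<close>), so \<open>D \<le> K * exp (- s * c) * N (a - b)\<close> for some
  constant \<open>K\<close> that depends on \<open>\<tau>\<close> only.

  The constant \<open>K\<close> may be much larger than \<open>1 + \<epsilon>\<close>. It is brought down by interpolating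
  geometrically between the two bounds (\<open>min_one_exp_le\<close>): for small \<open>\<theta> > 0\<close> the \<open>\<theta>\<close>-th power of
  \<open>K * exp (- s * c)\<close>, times the \<open>(1 - \<theta>)\<close>-th power of \<open>1\<close>, has constant at most \<open>1 + \<epsilon>\<close>, and
  it still decays exponentially, with rate \<open>l = c * \<theta>\<close>. A small overshoot is thus paid for by a
  slower rate.\<close>

lemma is_norm_continuous_on:
  fixes N :: "'a::euclidean_space \<Rightarrow> real"
  assumes "is_norm N"
  shows "continuous_on UNIV N"
proof (rule convex_on_continuous)
  show "convex_on UNIV N"
  proof (rule convex_onI)
    fix t :: real and x y :: 'a
    assume t: "0 < t" "t < 1"
    have "N ((1 - t) *\<^sub>R x + t *\<^sub>R y) \<le> N ((1 - t) *\<^sub>R x) + N (t *\<^sub>R y)"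
      using assms unfolding is_norm_def by blast
    also have "\<dots> = (1 - t) * N x + t * N y"
      using assms t by (simp add: is_norm_def)
    finally show "N ((1 - t) *\<^sub>R x + t *\<^sub>R y) \<le> (1 - t) * N x + t * N y" .
  qed simp
qed simp

text \<open>The quotient \<open>N / M\<close> is continuous on the Euclidean unit sphere, hence bounded there, and it is
  constant along rays.\<close>

lemma is_norm_equivalent:
  fixes N M :: "'a::euclidean_space \<Rightarrow> real"
  assumes N: "is_norm N" and M: "is_norm M"
  shows "\<exists>K>0. \<forall>y. N y \<le> K * M y"
proof -
  have "M u \<noteq> 0" if "u \<in> sphere 0 1" for u
    using M that unfolding is_norm_def by force
  then have "continuous_on (sphere 0 1) (\<lambda>u. N u / M u)"
    by (intro continuous_on_divide continuous_on_subset[OF is_norm_continuous_on] N M) auto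
  then have "bounded ((\<lambda>u. N u / M u) ` sphere 0 1)"
    by (intro compact_imp_bounded compact_continuous_image compact_sphere)
  then obtain K where K: "K > 0" "\<And>u. u \<in> sphere 0 1 \<Longrightarrow> \<bar>N u / M u\<bar> \<le> K"
    unfolding bounded_pos by auto
  have "N y \<le> K * M y" for y
  proof (cases "y = 0")
    case True
    moreover have "N 0 = 0" "M 0 = 0" using N M unfolding is_norm_def by blast+
    ultimately show ?thesis by simp
  next
    case False
    define u where "u = y /\<^sub>R norm y"
    have u: "u \<in> sphere 0 1" "y = norm y *\<^sub>R u"
      using False by (auto simp: u_def)
    have "M u > 0"
      using M u False unfolding is_norm_def by (metis less_eq_real_def scaleR_zero_right)
    then have "N u \<le> K * M u"
      using K(2)[OF u(1)] by (simp add: abs_le_iff divide_le_eq)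
    then have "norm y * N u \<le> norm y * (K * M u)"
      by (rule mult_left_mono) simp
    moreover have "N y = norm y * N u" "M y = norm y * M u"
      using N M u(2) unfolding is_norm_def by (metis abs_norm_cancel)+
    ultimately show ?thesis by (simp add: algebra_simps)
  qed
  with K(1) show ?thesis by blast
qed

text \<open>With \<open>u = ln K - s * c\<close>, so that \<open>exp u = K * exp (- s * c)\<close>, the minimum of \<open>1\<close> and \<open>exp u\<close>
  is at most their weighted geometric mean \<open>exp (\<theta> * u)\<close>, for any weight \<open>0 \<le> \<theta> \<le> 1\<close>.\<close>

lemma min_one_exp_le:
  fixes K c \<epsilon> :: real
  assumes "K > 0" "c > 0" "\<epsilon> > 0"
  shows "\<exists>l>0. \<forall>s\<ge>0. min 1 (K * exp (- s * c)) \<le> (1 + \<epsilon>) * exp (- s * l)"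
proof -
  define L where "L = ln (1 + \<epsilon>)"
  have L: "L > 0" "exp L = 1 + \<epsilon>" using assms by (simp_all add: L_def)
  \<comment> \<open>The weight is chosen so that \<open>\<theta> * ln K \<le> L\<close>, i.e. the \<open>\<theta>\<close>-th power of \<open>K\<close> is at most \<open>1 + \<epsilon>\<close>.\<close>
  define \<theta> where "\<theta> = L / (L + \<bar>ln K\<bar>)"
  have pos: "L + \<bar>ln K\<bar> > 0" using L by linarith
  have \<theta>: "0 < \<theta>" "\<theta> \<le> 1" using L pos by (simp_all add: \<theta>_def)
  have "\<theta> * ln K \<le> \<theta> * (L + \<bar>ln K\<bar>)"
    using L \<theta> by (intro mult_left_mono) auto
  also have "\<dots> = L" using pos by (simp add: \<theta>_def)
  finally have \<theta>K: "\<theta> * ln K \<le> L" .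
  have "min 1 (K * exp (- s * c)) \<le> (1 + \<epsilon>) * exp (- s * (c * \<theta>))" for s
  proof -
    define u where "u = ln K - s * c"
    have "min 1 (K * exp (- s * c)) = min 1 (exp u)"
      using \<open>K > 0\<close> by (simp add: u_def exp_diff exp_minus divide_inverse)
    also have "\<dots> \<le> exp (\<theta> * u)"
    proof (cases "u \<ge> 0")
      case False
      then have "u \<le> \<theta> * u" using \<theta> mult_right_mono_neg[of \<theta> 1 u] by simp
      then show ?thesis by (simp add: min_le_iff_disj)
    qed (use \<theta> in \<open>simp add: min_le_iff_disj\<close>)
    also have "\<dots> \<le> exp (L - s * (c * \<theta>))"
      using \<theta>K by (simp add: u_def algebra_simps)
    also have "\<dots> = (1 + \<epsilon>) * exp (- s * (c * \<theta>))"
      using L by (simp add: exp_diff exp_minus divide_inverse)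
    finally show ?thesis .
  qed
  moreover have "c * \<theta> > 0" using \<theta> assms by simp
  ultimately show ?thesis by blast
qed

lemma is_solution_trajectory:
  assumes "unique_global_solutions f \<Omega>" "0 \<le> r" "a \<in> \<Omega>"
  shows "is_solution f \<Omega> r a (\<lambda>t. trajectory f \<Omega> t r a)"
  using assms unfolding trajectory_def unique_global_solutions_def by (metis someI_ex)

lemma trajectory_in:
  assumes "unique_global_solutions f \<Omega>" "0 \<le> r" "a \<in> \<Omega>" "r \<le> t"
  shows "trajectory f \<Omega> t r a \<in> \<Omega>"
  using is_solution_trajectory[OF assms(1-3)] assms(4) by (simp add: is_solution_def)

text \<open>The restriction to \<open>{s..}\<close> of a solution started at time \<open>r\<close> is a solution started at time \<open>s\<close>,
  so by uniqueness it agrees on \<open>{s..}\<close> with the one that \<open>trajectory\<close> selects.\<close>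

lemma trajectory_cocycle:
  assumes U: "unique_global_solutions f \<Omega>"
    and r: "0 \<le> r" "r \<le> s" "s \<le> t" and a: "a \<in> \<Omega>"
  shows "trajectory f \<Omega> t s (trajectory f \<Omega> s r a) = trajectory f \<Omega> t r a"
proof -
  let ?b = "trajectory f \<Omega> s r a"
  have b: "?b \<in> \<Omega>" using trajectory_in[OF U r(1) a r(2)] .
  have "is_solution f \<Omega> s ?b (\<lambda>t. trajectory f \<Omega> t r a)"
    using is_solution_trajectory[OF U r(1) a] r(2)
    unfolding is_solution_def
    by (auto intro: has_vector_derivative_within_subset[where S = "{r..}"])
  moreover have "is_solution f \<Omega> s ?b (\<lambda>t. trajectory f \<Omega> t s ?b)"
    using r b by (intro is_solution_trajectory[OF U]) auto
  ultimately show ?thesis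
    using U r b unfolding unique_global_solutions_def by (meson order_trans)
qed

theorem theorem4:
  fixes f :: "real \<Rightarrow> real^'n \<Rightarrow> real^'n"
    and \<Omega> :: "(real^'n) set"
    and N :: "real^'n \<Rightarrow> real"
  assumes "convex \<Omega>"
    and "is_norm N"
    and "system_on f \<Omega>"
    and "nested_contractive f \<Omega> N"
  shows "SOST f \<Omega> N"
  unfolding SOST_def
proof (intro allI impI)
  let ?x = "trajectory f \<Omega>"
  fix \<epsilon> \<tau> :: real
  assume \<epsilon>: "\<epsilon> > 0" and \<tau>: "\<tau> > 0"
  have U: "unique_global_solutions f \<Omega>" using assms(3) by (simp add: system_on_def)
  have ne: "non_expansive f \<Omega> N" using assms(4) unfolding nested_contractive_def by blast
  have N0: "0 \<le> N y" for y using assms(2) by (simp add: is_norm_def)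
  obtain W :: "real \<Rightarrow> (real^'n) set" and M :: "real \<Rightarrow> real^'n \<Rightarrow> real" and z :: "real \<Rightarrow> real"
    where M: "\<forall>\<zeta>\<in>{0<..1/2}. convex (W \<zeta>) \<and> W \<zeta> \<subseteq> \<Omega> \<and> is_norm (M \<zeta>)"
    and z: "\<forall>\<tau>>0. z \<tau> \<in> {0<..1/2} \<and>
              (\<forall>a\<in>\<Omega>. \<forall>t\<^sub>1\<ge>0. \<forall>t\<ge>t\<^sub>1 + \<tau>. ?x t t\<^sub>1 a \<in> W (z \<tau>)) \<and>
              contractive_on f \<Omega> (W (z \<tau>)) (M (z \<tau>))"
    using assms(4) unfolding nested_contractive_def by (elim exE conjE) (rule that)
  define P where "P = M (z \<tau>)"
  define S where "S = W (z \<tau>)"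
  have P: "is_norm P" using M z \<tau> unfolding P_def by blast
  have S: "?x t t\<^sub>1 a \<in> S" if "a \<in> \<Omega>" "t\<^sub>1 \<ge> 0" "t \<ge> t\<^sub>1 + \<tau>" for a t\<^sub>1 t
    using z \<tau> that unfolding S_def by blast
  have "contractive_on f \<Omega> S P" using z \<tau> unfolding S_def P_def by blast
  then obtain c where c: "c > 0"
    and contr: "\<And>r t a b. a \<in> S \<Longrightarrow> b \<in> S \<Longrightarrow> 0 \<le> r \<Longrightarrow> r \<le> t \<Longrightarrow>
           P (?x t r a - ?x t r b) \<le> exp (- (t - r) * c) * P (a - b)"
    unfolding contractive_on_def by blast
  obtain K1 where K1: "K1 > 0" "\<And>y. N y \<le> K1 * P y"
    using is_norm_equivalent[OF assms(2) P] by blast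
  obtain K2 where K2: "K2 > 0" "\<And>y. P y \<le> K2 * N y"
    using is_norm_equivalent[OF P assms(2)] by blast
  obtain l where l: "l > 0"
    and bound: "\<And>s. s \<ge> 0 \<Longrightarrow> min 1 (K1 * K2 * exp (- s * c)) \<le> (1 + \<epsilon>) * exp (- s * l)"
    using min_one_exp_le[of "K1 * K2" c \<epsilon>] K1(1) K2(1) c \<epsilon> by auto
  have "N (?x (t\<^sub>2 + \<tau>) t\<^sub>1 a - ?x (t\<^sub>2 + \<tau>) t\<^sub>1 b) \<le> (1 + \<epsilon>) * exp (- (t\<^sub>2 - t\<^sub>1) * l) * N (a - b)"
    if a: "a \<in> \<Omega>" and b: "b \<in> \<Omega>" and t: "0 \<le> t\<^sub>1" "t\<^sub>1 \<le> t\<^sub>2" for t\<^sub>1 t\<^sub>2 a b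
  proof -
    let ?D = "?x (t\<^sub>2 + \<tau>) t\<^sub>1 a - ?x (t\<^sub>2 + \<tau>) t\<^sub>1 b"
    let ?a = "?x (t\<^sub>1 + \<tau>) t\<^sub>1 a" and ?b = "?x (t\<^sub>1 + \<tau>) t\<^sub>1 b"
    let ?E = "exp (- (t\<^sub>2 - t\<^sub>1) * c)"
    have non_exp: "N (?x t t\<^sub>1 a - ?x t t\<^sub>1 b) \<le> N (a - b)" if "t > t\<^sub>1" for t
      using ne a b t that unfolding non_expansive_def by blast
    have flow: "?x (t\<^sub>2 + \<tau>) (t\<^sub>1 + \<tau>) (?x (t\<^sub>1 + \<tau>) t\<^sub>1 y) = ?x (t\<^sub>2 + \<tau>) t\<^sub>1 y" if "y \<in> \<Omega>" for y
      using t \<tau> that by (intro trajectory_cocycle[OF U]) auto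
    \<comment> \<open>The flow contracts during \<open>[t\<^sub>1 + \<tau>, t\<^sub>2 + \<tau>]\<close>, an interval of length \<open>t\<^sub>2 - t\<^sub>1\<close>. During the
      transient \<open>[t\<^sub>1, t\<^sub>1 + \<tau>]\<close> only non-expansiveness in \<open>N\<close> controls the distance.\<close>
    have "P ?D \<le> ?E * P (?a - ?b)"
      using contr[OF S[OF a, of t\<^sub>1 "t\<^sub>1 + \<tau>"] S[OF b, of t\<^sub>1 "t\<^sub>1 + \<tau>"], of "t\<^sub>1 + \<tau>" "t\<^sub>2 + \<tau>"] t \<tau>
      by (simp add: flow a b)
    also have "\<dots> \<le> ?E * (K2 * N (a - b))"
      using K2(2)[of "?a - ?b"] non_exp[of "t\<^sub>1 + \<tau>"] K2(1) \<tau>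
      by (intro mult_left_mono) (auto intro: order_trans)
    finally have "K1 * P ?D \<le> K1 * (?E * (K2 * N (a - b)))"
      using K1(1) by simp
    then have "N ?D \<le> K1 * K2 * ?E * N (a - b)"
      using K1(2)[of ?D] by (simp add: mult_ac)
    moreover have "N ?D \<le> 1 * N (a - b)"
      using non_exp[of "t\<^sub>2 + \<tau>"] t \<tau> by simp
    ultimately have "N ?D \<le> min 1 (K1 * K2 * ?E) * N (a - b)"
      by (simp add: min_def)
    also have "\<dots> \<le> (1 + \<epsilon>) * exp (- (t\<^sub>2 - t\<^sub>1) * l) * N (a - b)"
      using bound[of "t\<^sub>2 - t\<^sub>1"] t N0 by (intro mult_right_mono) auto
    finally show ?thesis .
  qed
  then show "\<exists>l>0. \<forall>t\<^sub>1 t\<^sub>2. \<forall>a\<in>\<Omega>. \<forall>b\<in>\<Omega>. 0 \<le> t\<^sub>1 \<and> t\<^sub>1 \<le> t\<^sub>2 \<longrightarrow>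
        N (?x (t\<^sub>2 + \<tau>) t\<^sub>1 a - ?x (t\<^sub>2 + \<tau>) t\<^sub>1 b) \<le> (1 + \<epsilon>) * exp (- (t\<^sub>2 - t\<^sub>1) * l) * N (a - b)"
    using l by blast
qed

end
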